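(* For the cycle $C_n$ on $n\ge 3$ vertices, $$fix_f(C_n)=\begin{cases}\frac{n}{n-2}, & \text{if } n \text{ is even},\\ \frac{n}{n-1}, & \text{if } n\text{ is odd}.\end{cases}$$
   Context: Let $\Gamma=\Gamma(G)$ be the automorphism group of a finite simple undirected graph $G$. For $u\in V(G)$, $O(u)$ is the $\Gamma$-orbit of $u$; for $x\in V(G)$, $\Gamma_x$ is the stabilizer of $x$ and $O_x(u)=\{\pi(u):\pi\in\Gamma_x\}$. Let $V_a(G)=\{(u,v): u\neq v,\ O(u)=O(v)\}$. For vertices $u,v$ let $F(u,v)=\{x\in V(G):O_x(u)\neq O_x(v)\}$. A function $g:V(G)\to[0,1]$ is a fixing function of $G$ if $\sum_{x\in F(u,v)}g(x)\ge 1$ for every $(u,v)\in V_a(G)$. Put $|g|=\sum_{x\in V(G)}g(x)$. The fractional fixing number $fix_f(G)$ is the minimum of $|g|$ over all fixing functions $g$ of $G$. *)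

theory Defs
  imports
    "HOL-Analysis.Analysis"
    "HOL-Combinatorics.Permutations"
    "Graph_Theory.Graph_Theory"
begin

text \<open>
  Finite simple undirected graphs are taken from the library as the locale \<^locale>\<open>pair_graph\<close>:
  the edge set is an irreflexive symmetric relation on a finite vertex set.
  An automorphism is a permutation of the vertex set that
  preserves adjacency in both directions. By the convention of \<^const>\<open>permutes\<close> it is the identity
  outside the vertex set, so that distinct automorphisms are distinct functions.
\<close>

definition automorphisms :: "'a pair_pre_digraph \<Rightarrow> ('a \<Rightarrow> 'a) set" where
  "automorphisms G =
    {\<pi>. \<pi> permutes pverts G \<and>
        (\<forall>u\<in>pverts G. \<forall>v\<in>pverts G. (u, v) \<in> parcs G \<longleftrightarrow> (\<pi> u, \<pi> v) \<in> parcs G)}"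

definition vertex_stabilizer :: "'a pair_pre_digraph \<Rightarrow> 'a \<Rightarrow> ('a \<Rightarrow> 'a) set" where
  "vertex_stabilizer G x = {\<pi> \<in> automorphisms G. \<pi> x = x}"

definition vertex_orbit :: "'a pair_pre_digraph \<Rightarrow> 'a \<Rightarrow> 'a set" where
  "vertex_orbit G u = {\<pi> u |\<pi>. \<pi> \<in> automorphisms G}"

definition stabilizer_orbit :: "'a pair_pre_digraph \<Rightarrow> 'a \<Rightarrow> 'a \<Rightarrow> 'a set" where
  "stabilizer_orbit G x u = {\<pi> u |\<pi>. \<pi> \<in> vertex_stabilizer G x}"

definition similar_pairs :: "'a pair_pre_digraph \<Rightarrow> ('a \<times> 'a) set" where
  "similar_pairs G =
    {(u, v) \<in> pverts G \<times> pverts G. u \<noteq> v \<and> vertex_orbit G u = vertex_orbit G v}"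

definition fixing_vertices :: "'a pair_pre_digraph \<Rightarrow> 'a \<Rightarrow> 'a \<Rightarrow> 'a set" where
  "fixing_vertices G u v =
    {x \<in> pverts G. stabilizer_orbit G x u \<noteq> stabilizer_orbit G x v}"

definition fixing_function :: "'a pair_pre_digraph \<Rightarrow> ('a \<Rightarrow> real) \<Rightarrow> bool" where
  "fixing_function G g \<longleftrightarrow>
    g \<in> pverts G \<rightarrow> {0..1} \<and>
    (\<forall>(u, v) \<in> similar_pairs G. (\<Sum>x\<in>fixing_vertices G u v. g x) \<ge> 1)"

definition total_weight :: "'a pair_pre_digraph \<Rightarrow> ('a \<Rightarrow> real) \<Rightarrow> real" where
  "total_weight G g = (\<Sum>x\<in>pverts G. g x)"

text \<open>
  On the reals \<^const>\<open>Least\<close> denotes the minimum only if one exists; this is the case for every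
  finite simple graph, see \<open>fractional_fixing_number_is_minimum\<close> below.
\<close>

definition fractional_fixing_number :: "'a pair_pre_digraph \<Rightarrow> real" where
  "fractional_fixing_number G = (LEAST r. \<exists>g. fixing_function G g \<and> r = total_weight G g)"

definition cycle_graph :: "nat \<Rightarrow> nat pair_pre_digraph" where
  "cycle_graph n =
    \<lparr>pverts = {0..<n},
     parcs = {(i, j) \<in> {0..<n} \<times> {0..<n}. j = (i + 1) mod n \<or> i = (j + 1) mod n}\<rparr>"

lemma pair_graph_cycle_graph:
  assumes "n \<ge> 3"
  shows "pair_graph (cycle_graph n)"
proof -
  have loop: "i \<noteq> Suc i mod n" if "i < n" for i
    using that assms by (cases "Suc i = n") auto
  show ?thesis
  proof
    show "finite (parcs (cycle_graph n))"
      by (rule finite_subset[of _ "{0..<n} \<times> {0..<n}"]) (auto simp: cycle_graph_def)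
    show "symmetric (with_proj (cycle_graph n))"
      by (auto simp: symmetric_def cycle_graph_def intro!: symI)
    show "fst e \<noteq> snd e" if "e \<in> parcs (cycle_graph n)" for e
      using that loop by (force simp: cycle_graph_def)
  qed (auto simp: cycle_graph_def)
qed

lemma fixing_function_const_1:
  assumes "finite (pverts G)"
  shows "fixing_function G (\<lambda>_. 1)"
proof -
  have "1 \<le> (\<Sum>x\<in>fixing_vertices G u v. (1::real))" if "(u, v) \<in> similar_pairs G" for u v
  proof -
    have uv: "u \<in> pverts G" "u \<noteq> v"
      using that by (auto simp: similar_pairs_def)
    have id: "id \<in> vertex_stabilizer G u"
      by (simp add: vertex_stabilizer_def automorphisms_def permutes_id)
    have "stabilizer_orbit G u u \<subseteq> {u}"
      by (auto simp: stabilizer_orbit_def vertex_stabilizer_def)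
    moreover have "id v \<in> stabilizer_orbit G u v"
      using id unfolding stabilizer_orbit_def by blast
    ultimately have "stabilizer_orbit G u u \<noteq> stabilizer_orbit G u v"
      using uv by auto
    then have "u \<in> fixing_vertices G u v"
      using uv by (simp add: fixing_vertices_def)
    moreover have "finite (fixing_vertices G u v)"
      using assms by (simp add: fixing_vertices_def)
    ultimately have "1 \<le> card (fixing_vertices G u v)"
      by (metis One_nat_def Suc_leI card_gt_0_iff empty_iff)
    then show ?thesis by simp
  qed
  then show ?thesis
    by (auto simp: fixing_function_def)
qed

theorem fractional_fixing_number_is_minimum:
  assumes "pair_graph G"
  shows "\<exists>g. fixing_function G g \<and> fractional_fixing_number G = total_weight G g"
    and "fixing_function G h \<Longrightarrow> fractional_fixing_number G \<le> total_weight G h"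
proof -
  interpret pair_graph G by fact
  let ?V = "pverts G"
  have fin: "finite ?V" by (rule pair_finite_verts)
  define B :: "('a \<Rightarrow> real) set" where "B = PiE UNIV (\<lambda>_. {0..1})"
  define K where
    "K = B \<inter> (\<Inter>(u, v)\<in>similar_pairs G. {g. 1 \<le> (\<Sum>x\<in>fixing_vertices G u v. g x)})"
  have "compact B"
    unfolding B_def
    using compactin_PiE[of "\<lambda>_::'a. euclidean :: real topology" UNIV "\<lambda>_. {0..1}"]
    by (simp add: euclidean_product_topology)
  moreover have "closed (\<Inter>(u, v)\<in>similar_pairs G. {g. 1 \<le> (\<Sum>x\<in>fixing_vertices G u v. g x :: real)})"
    by (intro closed_INT ballI)
       (auto intro!: closed_Collect_le continuous_on_sum)
  ultimately have "compact K"
    unfolding K_def by (rule compact_Int_closed)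
  moreover have "(\<lambda>_. 1) \<in> K"
    using fixing_function_const_1[OF fin] by (auto simp: K_def B_def fixing_function_def)
  then have "K \<noteq> {}" by blast
  moreover have "continuous_on K (total_weight G)"
    unfolding total_weight_def
    by (intro continuous_on_sum continuous_on_subset[OF continuous_on_product_coordinates]) auto
  ultimately obtain g where g: "g \<in> K" "\<And>h. h \<in> K \<Longrightarrow> total_weight G g \<le> total_weight G h"
    using continuous_attains_inf by metis
  have gfix: "fixing_function G g"
    using g(1) by (auto simp: K_def B_def fixing_function_def)
  have gmin: "total_weight G g \<le> total_weight G h" if h: "fixing_function G h" for h
  proof -
    define h' where "h' = (\<lambda>x. if x \<in> ?V then h x else 0)"
    have eq: "(\<Sum>x\<in>fixing_vertices G u v. h' x) = (\<Sum>x\<in>fixing_vertices G u v. h x)" for u v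
      by (rule sum.cong) (auto simp: h'_def fixing_vertices_def)
    have "h' \<in> B"
      using h unfolding B_def fixing_function_def by (auto simp: h'_def Pi_iff)
    then have "h' \<in> K"
      using h by (auto simp: K_def fixing_function_def eq)
    from g(2)[OF this] show ?thesis
      by (simp add: total_weight_def h'_def)
  qed
  have eq: "fractional_fixing_number G = total_weight G g"
    unfolding fractional_fixing_number_def
    by (rule Least_equality) (use gfix gmin in auto)
  show "\<exists>g. fixing_function G g \<and> fractional_fixing_number G = total_weight G g"
    using gfix eq by blast
  show "fixing_function G h \<Longrightarrow> fractional_fixing_number G \<le> total_weight G h"
    using gmin eq by simp
qed

end

theory Submission
  imports Defs "HOL-Number_Theory.Cong"
begin

text \<open>
  Vertices are residues modulo \<open>n\<close>. An automorphism that fixes \<open>x\<close> sends \<open>x + 1\<close> to \<open>x + 1\<close> or to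
  \<open>x - 1\<close>, and walking around the cycle this choice determines it: it is the identity or the
  reflection \<open>i \<mapsto> 2x - i\<close>. The orbit of \<open>u\<close> under the stabilizer of \<open>x\<close> is therefore
  \<open>{u, 2x - u}\<close>, and \<open>x\<close> fails to separate two distinct vertices \<open>u\<close> and \<open>v\<close> exactly if
  \<open>2x \<equiv> u + v\<close> modulo \<open>n\<close> (\<open>fixing_vertices_cycle_graph\<close>). This congruence has either no solution
  \<open>x\<close> or exactly \<open>d = gcd n 2\<close> solutions in \<open>{0..<n}\<close>.

  As every pair of distinct vertices is thus separated by at least \<open>n - d\<close> vertices, the constant
  function \<open>1 / (n - d)\<close> is fixing, and it has weight \<open>n / (n - d)\<close>. Conversely, a pair
  \<open>(x + 1, x - 1)\<close> is separated exactly by the \<open>n - d\<close> vertices \<open>y\<close> for which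
  \<open>2y\<close> and \<open>2x\<close> are incongruent modulo \<open>n\<close>.
  Adding the constraints of these \<open>n\<close> pairs counts every \<open>g y\<close> exactly \<open>n - d\<close> times, whence
  \<open>(n - d) * |g| \<ge> n\<close> for every fixing function \<open>g\<close>.
\<close>

section \<open>Residues as vertices\<close>

text \<open>
  Integer representatives make \<open>x - 1\<close> and \<open>2x - u\<close> meaningful without truncation.
\<close>

definition cycle_vertex :: "nat \<Rightarrow> int \<Rightarrow> nat" where
  "cycle_vertex n a = nat (a mod int n)"

lemma int_cycle_vertex: "n > 0 \<Longrightarrow> int (cycle_vertex n a) = a mod int n"
  by (simp add: cycle_vertex_def)

lemma cycle_vertex_less: "n > 0 \<Longrightarrow> cycle_vertex n a < n"
  using int_cycle_vertex[of n a] by (metis of_nat_0_less_iff of_nat_less_iff pos_mod_bound)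

lemma cycle_vertex_of_nat: "u < n \<Longrightarrow> cycle_vertex n (int u) = u"
  by (simp add: cycle_vertex_def)

lemma cycle_vertex_eq_iff:
  "n > 0 \<Longrightarrow> cycle_vertex n a = cycle_vertex n b \<longleftrightarrow> [a = b] (mod int n)"
  by (metis cong_def cycle_vertex_def int_cycle_vertex)

lemma cycle_vertex_eq_nat_iff:
  "u < n \<Longrightarrow> cycle_vertex n a = u \<longleftrightarrow> [a = int u] (mod int n)"
  using cycle_vertex_eq_iff[of n a "int u"] by (simp add: cycle_vertex_of_nat)

lemma pverts_cycle_graph: "pverts (cycle_graph n) = {0..<n}"
  by (simp add: cycle_graph_def)

lemma cycle_graph_arc_iff:
  assumes "u < n" "v < n"
  shows "(u, v) \<in> parcs (cycle_graph n) \<longleftrightarrow>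
    [int v = int u + 1] (mod int n) \<or> [int u = int v + 1] (mod int n)"
proof -
  have "j = (i + 1) mod n \<longleftrightarrow> [int j = int i + 1] (mod int n)" if "j < n" for i j
  proof -
    have "[int j = int i + 1] (mod int n) \<longleftrightarrow> [j = i + 1] (mod n)"
      using cong_int_iff[of j "i + 1" n] by (simp add: add.commute)
    then show ?thesis using that by (simp add: cong_def)
  qed
  then show ?thesis using assms by (auto simp: cycle_graph_def)
qed

lemma cycle_graph_arc_cycle_vertex_iff:
  assumes "n > 0"
  shows "(cycle_vertex n a, cycle_vertex n b) \<in> parcs (cycle_graph n) \<longleftrightarrow>
    [b = a + 1] (mod int n) \<or> [b = a - 1] (mod int n)"
proof -
  have "[a mod int n = b mod int n + 1] (mod int n) \<longleftrightarrow> [a = b + 1] (mod int n)"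
    by (simp add: cong_def mod_simps)
  also have "\<dots> \<longleftrightarrow> [b = a - 1] (mod int n)"
    by (simp add: cong_iff_dvd_diff dvd_diff_commute algebra_simps)
  finally have "[a mod int n = b mod int n + 1] (mod int n) \<longleftrightarrow> [b = a - 1] (mod int n)" .
  moreover have "[b mod int n = a mod int n + 1] (mod int n) \<longleftrightarrow> [b = a + 1] (mod int n)"
    by (simp add: cong_def mod_simps)
  ultimately show ?thesis
    using assms by (simp add: cycle_graph_arc_iff cycle_vertex_less int_cycle_vertex)
qed

section \<open>Automorphisms\<close>

text \<open>
  The value outside the vertex set is the one that \<^const>\<open>permutes\<close> demands.
\<close>

definition cycle_reflection :: "nat \<Rightarrow> int \<Rightarrow> nat \<Rightarrow> nat" where
  "cycle_reflection n c i = (if i < n then cycle_vertex n (c - int i) else i)"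

lemma cycle_reflection_automorphism:
  assumes "n > 0"
  shows "cycle_reflection n c \<in> automorphisms (cycle_graph n)"
proof -
  have less: "cycle_vertex n (c - int i) < n" for i
    using assms by (rule cycle_vertex_less)
  have "cycle_vertex n (c - int (cycle_vertex n (c - int i))) = i" if "i < n" for i
    using that assms
    by (simp add: cycle_vertex_eq_nat_iff int_cycle_vertex cong_def mod_simps)
  then have "cycle_reflection n c permutes {0..<n}"
    by (intro bij_imp_permutes bij_betw_byWitness[where f' = "cycle_reflection n c"])
       (auto simp: cycle_reflection_def less)
  moreover have "(u, v) \<in> parcs (cycle_graph n) \<longleftrightarrow>
      (cycle_reflection n c u, cycle_reflection n c v) \<in> parcs (cycle_graph n)"
    if "u < n" "v < n" for u v
  proof -
    have "[int v = int u + 1] (mod int n) \<longleftrightarrow> [c - int v = c - int u - 1] (mod int n)"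
      by (simp add: cong_iff_dvd_diff dvd_diff_commute algebra_simps)
    moreover have "[int u = int v + 1] (mod int n) \<longleftrightarrow> [c - int v = c - int u + 1] (mod int n)"
      by (simp add: cong_iff_dvd_diff algebra_simps)
    ultimately show ?thesis
      using that assms
      by (auto simp: cycle_reflection_def cycle_graph_arc_iff[OF that]
            cycle_graph_arc_cycle_vertex_iff)
  qed
  ultimately show ?thesis
    by (auto simp: automorphisms_def pverts_cycle_graph)
qed

text \<open>
  Reflections alone act transitively: the one that exchanges \<open>u\<close> and \<open>w\<close> has parameter \<open>u + w\<close>.
\<close>

lemma vertex_orbit_cycle_graph:
  assumes "u < n"
  shows "vertex_orbit (cycle_graph n) u = {0..<n}"
proof
  show "vertex_orbit (cycle_graph n) u \<subseteq> {0..<n}"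
    using assms permutes_in_image[of _ "{0..<n}" u]
    by (auto simp: vertex_orbit_def automorphisms_def pverts_cycle_graph)
  show "{0..<n} \<subseteq> vertex_orbit (cycle_graph n) u"
  proof
    fix w assume "w \<in> {0..<n}"
    then have "w = cycle_reflection n (int u + int w) u"
      using assms by (simp add: cycle_reflection_def cycle_vertex_of_nat)
    then show "w \<in> vertex_orbit (cycle_graph n) u"
      using cycle_reflection_automorphism[of n "int u + int w"] assms
      unfolding vertex_orbit_def by fastforce
  qed
qed

lemma similar_pairs_cycle_graph:
  "similar_pairs (cycle_graph n) = {(u, v). u < n \<and> v < n \<and> u \<noteq> v}"
  by (auto simp: similar_pairs_def pverts_cycle_graph vertex_orbit_cycle_graph)

text \<open>
  The sign \<open>e\<close> records the image of the first step away from \<open>x\<close>. Each later step continues in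
  the same direction because the only other neighbour is already the image of the preceding
  vertex; for this, the vertices two steps apart have to be distinct, that is, \<open>n \<ge> 3\<close>.
\<close>

lemma cycle_automorphism_fixing_vertex:
  assumes "n \<ge> 3" "\<pi> \<in> automorphisms (cycle_graph n)" "x < n" "\<pi> x = x"
  obtains e where "e = 1 \<or> e = -1"
    "\<And>u. u < n \<Longrightarrow> \<pi> u = cycle_vertex n (int x + e * (int u - int x))"
proof -
  have n: "n > 0" using assms(1) by simp
  let ?c = "cycle_vertex n"
  have perm: "\<pi> permutes {0..<n}"
    using assms(2) by (simp add: automorphisms_def pverts_cycle_graph)
  have adj: "(\<pi> (?c a), \<pi> (?c (a + 1))) \<in> parcs (cycle_graph n)" for a
  proof -
    have "(?c a, ?c (a + 1)) \<in> parcs (cycle_graph n)"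
      using n by (simp add: cycle_graph_arc_cycle_vertex_iff)
    then show ?thesis
      using assms(2) cycle_vertex_less[OF n]
      by (auto simp: automorphisms_def pverts_cycle_graph)
  qed
  have next_vertex: "\<pi> (?c (a + 1)) = ?c (b + 1) \<or> \<pi> (?c (a + 1)) = ?c (b - 1)"
    if "\<pi> (?c a) = ?c b" for a b
  proof -
    have "\<pi> (?c (a + 1)) < n"
      using permutes_in_image[OF perm, of "?c (a + 1)"] cycle_vertex_less[OF n] by simp
    then have "\<pi> (?c (a + 1)) = ?c (int (\<pi> (?c (a + 1))))"
      by (simp add: cycle_vertex_of_nat)
    then show ?thesis
      using adj[of a] that n cycle_graph_arc_cycle_vertex_iff[OF n] cycle_vertex_eq_iff[OF n]
      by metis
  qed
  have px: "\<pi> (?c (int x)) = ?c (int x)"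
    using assms by (simp add: cycle_vertex_of_nat)
  obtain e :: int where e: "e = 1 \<or> e = -1" "\<pi> (?c (int x + 1)) = ?c (int x + e)"
    using next_vertex[OF px] by (metis diff_conv_add_uminus)
  have walk: "\<pi> (?c (int x + int k)) = ?c (int x + e * int k) \<and>
      \<pi> (?c (int x + int k + 1)) = ?c (int x + e * (int k + 1))" for k
  proof (induction k)
    case 0
    then show ?case using px e by simp
  next
    case (Suc k)
    have "?c (int x + int k + 2) \<noteq> ?c (int x + int k)"
      using assms(1) n zdvd_imp_le[of "int n" 2]
      by (auto simp: cycle_vertex_eq_iff cong_iff_dvd_diff)
    then have ne: "\<pi> (?c (int x + int k + 2)) \<noteq> ?c (int x + e * int k)"
      using Suc permutes_inj[OF perm] by (metis injD)
    have "\<pi> (?c (int x + int k + 2)) = ?c (int x + e * (int k + 1) + 1) \<or>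
        \<pi> (?c (int x + int k + 2)) = ?c (int x + e * (int k + 1) - 1)"
      using next_vertex[of "int x + int k + 1" "int x + e * (int k + 1)"] Suc
      by (simp add: add.assoc)
    then have "\<pi> (?c (int x + int k + 2)) = ?c (int x + e * (int k + 2))"
      using ne e(1) by (auto simp: algebra_simps)
    then show ?case using Suc by (simp add: algebra_simps)
  qed
  have "\<pi> u = ?c (int x + e * (int u - int x))" if u: "u < n" for u
  proof -
    \<comment> \<open>the number of forward steps that lead from \<open>x\<close> to \<open>u\<close>\<close>
    define k where "k = nat ((int u - int x) mod int n)"
    have k: "[int k = int u - int x] (mod int n)"
      using n by (simp add: k_def cong_def)
    have "?c (int x + int k) = u"
      using u cong_add[OF cong_refl[of "int x"] k] by (simp add: cycle_vertex_eq_nat_iff)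
    moreover have "?c (int x + e * int k) = ?c (int x + e * (int u - int x))"
      using n k by (simp add: cycle_vertex_eq_iff cong_add cong_scalar_left)
    ultimately show ?thesis using walk[of k] by simp
  qed
  then show ?thesis using that e(1) by blast
qed

lemma stabilizer_orbit_cycle_graph:
  assumes "n \<ge> 3" "x < n" "u < n"
  shows "stabilizer_orbit (cycle_graph n) x u = {u, cycle_vertex n (2 * int x - int u)}"
    (is "_ = {u, ?r}")
proof
  have "\<pi> u \<in> {u, ?r}" if \<pi>: "\<pi> \<in> automorphisms (cycle_graph n)" "\<pi> x = x" for \<pi>
  proof -
    obtain e where "e = 1 \<or> e = -1" "\<pi> u = cycle_vertex n (int x + e * (int u - int x))"
      using cycle_automorphism_fixing_vertex[OF assms(1) \<pi>(1) assms(2) \<pi>(2)] assms(3)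
      by metis
    then show ?thesis
      using assms(3) by (auto simp: cycle_vertex_of_nat algebra_simps)
  qed
  then show "stabilizer_orbit (cycle_graph n) x u \<subseteq> {u, ?r}"
    by (auto simp: stabilizer_orbit_def vertex_stabilizer_def)
  have "id \<in> vertex_stabilizer (cycle_graph n) x"
    by (simp add: vertex_stabilizer_def automorphisms_def permutes_id)
  moreover have "cycle_reflection n (2 * int x) \<in> vertex_stabilizer (cycle_graph n) x"
    using assms cycle_reflection_automorphism[of n]
    by (simp add: vertex_stabilizer_def cycle_reflection_def cycle_vertex_of_nat)
  moreover have "cycle_reflection n (2 * int x) u = ?r"
    using assms by (simp add: cycle_reflection_def)
  ultimately show "{u, ?r} \<subseteq> stabilizer_orbit (cycle_graph n) x u"
    unfolding stabilizer_orbit_def by (auto; metis id_apply)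
qed

text \<open>
  For \<open>u \<noteq> v\<close> the orbits \<open>{u, 2x - u}\<close> and \<open>{v, 2x - v}\<close> coincide only if the reflection at \<open>x\<close>
  exchanges \<open>u\<close> and \<open>v\<close>.
\<close>

lemma fixing_vertices_cycle_graph:
  assumes "n \<ge> 3" "u < n" "v < n" "u \<noteq> v"
  shows "fixing_vertices (cycle_graph n) u v = {0..<n} - {x. x < n \<and> [2 * x = u + v] (mod n)}"
proof -
  have "stabilizer_orbit (cycle_graph n) x u = stabilizer_orbit (cycle_graph n) x v \<longleftrightarrow>
      [2 * x = u + v] (mod n)" if x: "x < n" for x
  proof -
    have 1: "cycle_vertex n (2 * int x - int u) = v \<longleftrightarrow> [2 * x = u + v] (mod n)"
      using assms cong_int_iff[of "2 * x" "u + v" n]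
      by (simp add: cycle_vertex_eq_nat_iff cong_iff_dvd_diff algebra_simps)
    have 2: "cycle_vertex n (2 * int x - int v) = u \<longleftrightarrow> [2 * x = u + v] (mod n)"
      using assms cong_int_iff[of "2 * x" "u + v" n]
      by (simp add: cycle_vertex_eq_nat_iff cong_iff_dvd_diff algebra_simps)
    show ?thesis
      using assms x 1 2 by (auto simp: stabilizer_orbit_cycle_graph doubleton_eq_iff)
  qed
  then show ?thesis
    by (auto simp: fixing_vertices_def pverts_cycle_graph)
qed

section \<open>Counting solutions of the doubling congruence\<close>

text \<open>
  For odd \<open>n\<close> the factor 2 cancels. For \<open>n = 2m\<close> the congruence says \<open>x \<equiv> y\<close> modulo \<open>m\<close>, and the
  two solutions are antipodal vertices of the cycle.
\<close>

lemma card_double_cong_double: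
  fixes n y :: nat
  assumes "y < n"
  shows "card {x. x < n \<and> [2 * x = 2 * y] (mod n)} = gcd n 2"
proof (cases "even n")
  case True
  then obtain m where m: "n = 2 * m" by blast
  define r where "r = y mod m"
  have "m > 0" using assms m by simp
  then have r: "r < m" by (simp add: r_def)
  have "[2 * x = 2 * y] (mod n) \<longleftrightarrow> x mod m = r" for x
    by (simp add: cong_def m r_def mult_mod_right[symmetric])
  moreover have "x < n \<and> x mod m = r \<longleftrightarrow> x = r \<or> x = r + m" for x
  proof
    assume x: "x < n \<and> x mod m = r"
    then have "x div m < 2" using m by (simp add: less_mult_imp_div_less)
    then have "x div m = 0 \<or> x div m = 1" by linarith
    then show "x = r \<or> x = r + m"
      using x div_mult_mod_eq[of x m] by auto
  qed (use r m in auto)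
  ultimately have "{x. x < n \<and> [2 * x = 2 * y] (mod n)} = {r, r + m}" by auto
  then show ?thesis using \<open>m > 0\<close> m by simp
next
  case False
  then have cop: "coprime 2 n" by simp
  have "{x. x < n \<and> [2 * x = 2 * y] (mod n)} = {y}"
    using assms cong_mult_lcancel_nat[OF cop] by (auto simp: cong_def)
  then show ?thesis using cop by (simp add: gcd.commute)
qed

text \<open>
  The solutions form a coset of the kernel of doubling as soon as there is one. The bound is strict
  if \<open>n\<close> is even and \<open>c\<close> is odd.
\<close>

lemma card_double_cong_le:
  "card {x. x < n \<and> [2 * x = c] (mod n)} \<le> gcd n (2::nat)"
proof (cases "\<exists>y<n. [2 * y = c] (mod n)")
  case True
  then obtain y where y: "y < n" "[2 * y = c] (mod n)" by blast
  have "{x. x < n \<and> [2 * x = c] (mod n)} = {x. x < n \<and> [2 * x = 2 * y] (mod n)}"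
    using y(2) by (auto simp: cong_def)
  then show ?thesis using card_double_cong_double[OF y(1)] by simp
next
  case False
  then have "{x. x < n \<and> [2 * x = c] (mod n)} = {}" by blast
  then show ?thesis by (simp only: card.empty le0)
qed

section \<open>The fractional fixing number\<close>

lemma fixing_function_cycle_graph_const:
  assumes "n \<ge> 3"
  shows "fixing_function (cycle_graph n) (\<lambda>_. 1 / (real n - real (gcd n 2)))"
proof -
  let ?d = "gcd n 2"
  have d: "?d \<le> 2" by (rule gcd_le2_nat) simp
  then have pos: "real n - real ?d \<ge> 1" using assms by linarith
  have "1 \<le> (\<Sum>x\<in>fixing_vertices (cycle_graph n) u v. 1 / (real n - real ?d))"
    if uv: "u < n" "v < n" "u \<noteq> v" for u v
  proof -
    let ?N = "{x. x < n \<and> [2 * x = u + v] (mod n)}"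
    have "card (fixing_vertices (cycle_graph n) u v) = n - card ?N"
      unfolding fixing_vertices_cycle_graph[OF assms uv]
      by (subst card_Diff_subset) auto
    moreover have "card ?N \<le> ?d" by (rule card_double_cong_le)
    ultimately have "real n - real ?d \<le> real (card (fixing_vertices (cycle_graph n) u v))"
      by linarith
    then show ?thesis using pos by (simp add: field_simps)
  qed
  then show ?thesis
    using pos by (auto simp: fixing_function_def similar_pairs_cycle_graph)
qed

lemma fixing_function_cycle_graph_double_cong:
  assumes "n \<ge> 3" "fixing_function (cycle_graph n) g" "x < n"
  shows "1 + (\<Sum>y | y < n \<and> [2 * y = 2 * x] (mod n). g y) \<le> total_weight (cycle_graph n) g"
proof -
  \<comment> \<open>the two neighbours of \<open>x\<close>, which are exchanged by the reflection fixing \<open>x\<close>\<close>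
  define u where "u = cycle_vertex n (int x + 1)"
  define v where "v = cycle_vertex n (int x - 1)"
  have n: "n > 0" using assms(1) by simp
  have less: "u < n" "v < n" by (simp_all add: u_def v_def cycle_vertex_less n)
  have ne: "u \<noteq> v"
    using assms(1) n zdvd_imp_le[of "int n" 2]
    by (auto simp: u_def v_def cycle_vertex_eq_iff cong_iff_dvd_diff)
  have "[int (u + v) = int (2 * x)] (mod int n)"
    by (simp add: u_def v_def int_cycle_vertex n cong_def mod_simps)
  then have sum_uv: "[u + v = 2 * x] (mod n)" by (simp only: cong_int_iff)
  let ?N = "{y. y < n \<and> [2 * y = 2 * x] (mod n)}"
  have "?N = {y. y < n \<and> [2 * y = u + v] (mod n)}"
    using sum_uv by (auto simp: cong_def)
  then have F: "fixing_vertices (cycle_graph n) u v = {0..<n} - ?N"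
    using fixing_vertices_cycle_graph[OF assms(1) less ne] by simp
  have "1 \<le> sum g ({0..<n} - ?N)"
    using assms(2) less ne unfolding F[symmetric]
    by (simp add: fixing_function_def similar_pairs_cycle_graph)
  also have "\<dots> = sum g {0..<n} - sum g ?N"
    by (rule sum_diff) auto
  finally show ?thesis by (simp add: total_weight_def pverts_cycle_graph)
qed

text \<open>
  The constraints of the pairs of vertices at either side of \<open>x\<close> are added over all \<open>x\<close>. Since the
  relation \<open>2y \<equiv> 2x\<close> is symmetric, exchanging the sums shows that each \<open>g y\<close> is missing from exactly
  \<open>gcd n 2\<close> of the \<open>n\<close> constraints.
\<close>

lemma total_weight_fixing_function_cycle_graph_ge:
  assumes "n \<ge> 3" "fixing_function (cycle_graph n) g"
  shows "real n \<le> (real n - real (gcd n 2)) * total_weight (cycle_graph n) g"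
proof -
  let ?W = "total_weight (cycle_graph n) g"
  let ?R = "\<lambda>x y. [2 * y = 2 * x] (mod n)"
  have "real n + (\<Sum>x<n. \<Sum>y | y < n \<and> ?R x y. g y) =
      (\<Sum>x<n. 1 + (\<Sum>y | y < n \<and> ?R x y. g y))"
    by (simp add: sum.distrib)
  also have "\<dots> \<le> (\<Sum>x<n. ?W)"
    using assms by (intro sum_mono fixing_function_cycle_graph_double_cong) auto
  also have "\<dots> = real n * ?W" by simp
  finally have "real n + (\<Sum>x<n. \<Sum>y | y < n \<and> ?R x y. g y) \<le> real n * ?W" .
  moreover have "(\<Sum>x<n. \<Sum>y | y < n \<and> ?R x y. g y) = real (gcd n 2) * ?W"
  proof -
    have "(\<Sum>x<n. \<Sum>y | y < n \<and> ?R x y. g y) = (\<Sum>y<n. \<Sum>x | x < n \<and> ?R y x. g y)"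
      using sum.swap_restrict[of "{..<n}" "{..<n}" "\<lambda>_. g" ?R] by (simp add: cong_sym_eq)
    also have "\<dots> = (\<Sum>y<n. real (gcd n 2) * g y)"
      by (rule sum.cong) (simp_all add: card_double_cong_double)
    finally show ?thesis
      by (simp add: total_weight_def pverts_cycle_graph sum_distrib_left atLeast0LessThan)
  qed
  ultimately show ?thesis by (simp add: algebra_simps)
qed

lemma fractional_fixing_number_cycle_graph:
  assumes "n \<ge> 3"
  shows "fractional_fixing_number (cycle_graph n) = real n / (real n - real (gcd n 2))"
proof (rule antisym)
  let ?d = "gcd n 2"
  have "?d \<le> 2" by (rule gcd_le2_nat) simp
  then have pos: "real n - real ?d > 0" using assms by linarith
  note minimum = fractional_fixing_number_is_minimum[OF pair_graph_cycle_graph[OF assms]]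
  show "fractional_fixing_number (cycle_graph n) \<le> real n / (real n - real ?d)"
    using minimum(2)[OF fixing_function_cycle_graph_const[OF assms]]
    by (simp add: total_weight_def pverts_cycle_graph)
  obtain g where g: "fixing_function (cycle_graph n) g"
      "fractional_fixing_number (cycle_graph n) = total_weight (cycle_graph n) g"
    using minimum(1) by blast
  show "real n / (real n - real ?d) \<le> fractional_fixing_number (cycle_graph n)"
    using total_weight_fixing_function_cycle_graph_ge[OF assms g(1)] pos g(2)
    by (simp add: field_simps)
qed

theorem corollary4p2:
  fixes n :: nat
  assumes "n \<ge> 3"
  shows "fractional_fixing_number (cycle_graph n) =
    (if even n then real n / (real n - 2) else real n / (real n - 1))"
proof (cases "even n")
  case True
  then have "gcd n 2 = 2" by (simp add: gcd_proj2_iff)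
  then show ?thesis using fractional_fixing_number_cycle_graph[OF assms] True by simp
next
  case False
  then have "gcd n 2 = 1" by (metis coprime_iff_gcd_eq_1 coprime_right_2_iff_odd)
  then show ?thesis using fractional_fixing_number_cycle_graph[OF assms] False by simp
qed

end
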